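(* Let $\mathcal X_n$ be a finite set with $n$ elements (graph vertices) with symmetric edge weights $w_{xy}=w_{yx}\ge0$ and $\deg(x)=\sum_{y\in\mathcal X_n}w_{xy}>0$ for all $x\in\mathcal X_n$. Suppose that $u:\mathcal X_n\to\mathbb R$ satisfies the Poisson equation $\mathcal Lu=\sum_{y\in\Gamma}a_y\delta_y$ on $\mathcal X_n$, where $\Gamma\subset\mathcal X_n$ and $a_y\in\mathbb R$ for $y\in\Gamma$, and assume that $\sum_{y\in\Gamma}a_y=0$. Then for every integer $k\ge1$ the function $u_k:=\mathcal H_k*u$ satisfies $(u_k)_{\deg}=(u)_{\deg}$ and $$u-u_k=\deg^{-1}\sum_{y\in\Gamma}a_y\sum_{j=0}^{k-1}\mathcal H^y_j\quad\text{on }\mathcal X_n.$$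
   Context: $\mathcal Lu(x)=\sum_{y\in\mathcal X_n}w_{xy}(u(x)-u(y))$ is the unnormalized graph Laplacian. For $x\in\mathcal X_n$, $\delta_x:\mathcal X_n\to\mathbb R$ is $\delta_x(x)=n$ and $\delta_x(y)=0$ for $y\ne x$. The heat kernel $\mathcal H^x_k:\mathcal X_n\to\mathbb R$ is defined by $\mathcal H^x_0=\delta_x$ and $\mathcal H^x_{k+1}(y)=\sum_{z\in\mathcal X_n}\frac{w_{yz}}{\deg(z)}\mathcal H^x_k(z)$ for $k\ge0$. Convolution with the heat kernel: $(\mathcal H_k*u)(x)=\frac1n\sum_{y\in\mathcal X_n}\mathcal H^x_k(y)u(y)$. Degree-weighted mean: $(u)_{\deg}=\frac{\sum_{x\in\mathcal X_n}\deg(x)u(x)}{\sum_{x\in\mathcal X_n}\deg(x)}$. *)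

theory Defs
  imports Complex_Main
begin

text \<open>
  A weighted graph is given by a vertex set \<open>X\<close> and a weight function \<open>w\<close>; the number of
  vertices \<open>n\<close> is \<open>card X\<close>.  Functions on the vertices are total functions on the ambient
  type, of which only the values on \<open>X\<close> matter.
\<close>

definition weighted_graph :: "'a set \<Rightarrow> ('a \<Rightarrow> 'a \<Rightarrow> real) \<Rightarrow> bool" where
  "weighted_graph X w \<longleftrightarrow>
     finite X \<and> (\<forall>x\<in>X. \<forall>y\<in>X. w x y = w y x \<and> 0 \<le> w x y)"

definition deg :: "'a set \<Rightarrow> ('a \<Rightarrow> 'a \<Rightarrow> real) \<Rightarrow> 'a \<Rightarrow> real" where
  "deg X w x = (\<Sum>y\<in>X. w x y)"

definition graph_laplacian ::
    "'a set \<Rightarrow> ('a \<Rightarrow> 'a \<Rightarrow> real) \<Rightarrow> ('a \<Rightarrow> real) \<Rightarrow> 'a \<Rightarrow> real" where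
  "graph_laplacian X w u x = (\<Sum>y\<in>X. w x y * (u x - u y))"

text \<open>The point mass has height \<open>n\<close>, i.e. unit mass for the normalized counting measure on \<open>X\<close>.\<close>

definition delta :: "'a set \<Rightarrow> 'a \<Rightarrow> 'a \<Rightarrow> real" where
  "delta X x y = (if y = x then real (card X) else 0)"

text \<open>\<open>heat_kernel X w x k\<close> is the function usually written as \<open>H\<close> with upper index \<open>x\<close>
  and lower index \<open>k\<close>.\<close>

primrec heat_kernel ::
    "'a set \<Rightarrow> ('a \<Rightarrow> 'a \<Rightarrow> real) \<Rightarrow> 'a \<Rightarrow> nat \<Rightarrow> 'a \<Rightarrow> real" where
  "heat_kernel X w x 0 = delta X x"
| "heat_kernel X w x (Suc k) = (\<lambda>y. \<Sum>z\<in>X. w y z / deg X w z * heat_kernel X w x k z)"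

definition heat_conv ::
    "'a set \<Rightarrow> ('a \<Rightarrow> 'a \<Rightarrow> real) \<Rightarrow> nat \<Rightarrow> ('a \<Rightarrow> real) \<Rightarrow> 'a \<Rightarrow> real" where
  "heat_conv X w k u x = 1 / real (card X) * (\<Sum>y\<in>X. heat_kernel X w x k y * u y)"

definition deg_mean :: "'a set \<Rightarrow> ('a \<Rightarrow> 'a \<Rightarrow> real) \<Rightarrow> ('a \<Rightarrow> real) \<Rightarrow> real" where
  "deg_mean X w u = (\<Sum>x\<in>X. deg X w x * u x) / (\<Sum>x\<in>X. deg X w x)"

end

theory Submission
  imports Defs
begin

text \<open>
  Let \<open>W\<close> and \<open>D\<close> be the weight and degree matrices.  The kernel after \<open>k\<close> steps is
  \<open>n (W D\<^sup>-\<^sup>1)\<^sup>k\<close>, so symmetry of \<open>W\<close> gives the reversibility relation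
  \<open>deg x * H\<^sup>x\<^sub>k y = deg y * H\<^sup>y\<^sub>k x\<close>.  Together with conservation of mass this preserves the
  degree-weighted mean.  Convolution acts as \<open>(D\<^sup>-\<^sup>1 W)\<^sup>k\<close>, hence \<open>u\<^sub>k - u\<^sub>k\<^sub>+\<^sub>1\<close> is the convolution of
  \<open>u - D\<^sup>-\<^sup>1 W u\<close>, the Laplacian of \<open>u\<close> divided by the degree; for a sum of point masses
  reversibility turns it into kernels based at the points of \<open>\<Gamma>\<close>, and the sum over \<open>k\<close> telescopes.
\<close>

lemma sum_delta_mult:
  fixes f :: "'a \<Rightarrow> real"
  assumes "finite X" "y \<in> X"
  shows "(\<Sum>z\<in>X. f z * delta X y z) = real (card X) * f y"
proof -
  have "(\<Sum>z\<in>X. f z * delta X y z) = (\<Sum>z\<in>X. if z = y then real (card X) * f z else 0)"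
    by (rule sum.cong) (auto simp: delta_def)
  then show ?thesis
    using assms by simp
qed

lemma delta_commute: "delta X x y = delta X y x"
  by (auto simp: delta_def)

lemma deg_nonzeroD:
  assumes "\<And>x. x \<in> X \<Longrightarrow> deg X w x > 0" "x \<in> X"
  shows "deg X w x \<noteq> 0"
  using assms by force

text \<open>A matrix commutes with its powers, so the extra factor that the recursion puts at the
  evaluation point can equally be put at the source.\<close>

lemma heat_kernel_Suc_source:
  assumes "finite X" "x \<in> X" "y \<in> X"
  shows "heat_kernel X w y (Suc k) x = (\<Sum>z\<in>X. heat_kernel X w z k x * (w z y / deg X w y))"
  using assms(2)
proof (induction k arbitrary: x)
  \<comment> \<open>Both sides equal \<open>real (card X) * (w x y / deg X w y)\<close>, the entry
    of a single step.\<close>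
  case 0
  have "(\<Sum>z\<in>X. delta X z x * (w z y / deg X w y))
      = (\<Sum>z\<in>X. w z y / deg X w y * delta X x z)"
    by (simp add: delta_commute mult.commute)
  then show ?case
    using sum_delta_mult[OF assms(1,3), of "\<lambda>z. w x z / deg X w z"]
      sum_delta_mult[OF assms(1) 0, of "\<lambda>z. w z y / deg X w y"]
    by simp
next
  case (Suc k)
  have "heat_kernel X w y (Suc (Suc k)) x
      = (\<Sum>v\<in>X. w x v / deg X w v * heat_kernel X w y (Suc k) v)"
    by simp
  also have "\<dots> = (\<Sum>v\<in>X. w x v / deg X w v *
      (\<Sum>z\<in>X. heat_kernel X w z k v * (w z y / deg X w y)))"
    by (rule sum.cong) (simp_all only: Suc.IH)
  also have "\<dots> = (\<Sum>z\<in>X. \<Sum>v\<in>X.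
      w x v / deg X w v * (heat_kernel X w z k v * (w z y / deg X w y)))"
    unfolding sum_distrib_left by (rule sum.swap)
  also have "\<dots> = (\<Sum>z\<in>X. heat_kernel X w z (Suc k) x * (w z y / deg X w y))"
    by (simp only: heat_kernel.simps sum_distrib_right mult.assoc)
  finally show ?case .
qed

text \<open>Exchanging the endpoints turns a step at the evaluation point into a step at the source,
  so the induction unfolds the definition on one side and \<open>heat_kernel_Suc_source\<close> on
  the other.\<close>

lemma heat_kernel_reversible:
  assumes graph: "weighted_graph X w"
    and pos: "\<And>x. x \<in> X \<Longrightarrow> deg X w x > 0"
    and "x \<in> X" "y \<in> X"
  shows "deg X w x * heat_kernel X w x k y = deg X w y * heat_kernel X w y k x"
  using assms(3,4)
proof (induction k arbitrary: x y)
  case 0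
  then show ?case
    by (simp add: delta_def)
next
  case (Suc k)
  have fin: "finite X" and sym: "\<And>x y. x \<in> X \<Longrightarrow> y \<in> X \<Longrightarrow> w x y = w y x"
    using graph by (auto simp: weighted_graph_def)
  have "deg X w x * heat_kernel X w x (Suc k) y
      = (\<Sum>z\<in>X. w y z / deg X w z * (deg X w x * heat_kernel X w x k z))"
    by (simp add: sum_distrib_left mult.left_commute)
  \<comment> \<open>The induction hypothesis for \<open>x\<close> and \<open>z\<close> supplies the
    factor \<open>deg X w z\<close>, which cancels the normalization of the step.\<close>
  also have "\<dots> = (\<Sum>z\<in>X. w z y * heat_kernel X w z k x)"
  proof (rule sum.cong[OF refl])
    fix z assume z: "z \<in> X"
    show "w y z / deg X w z * (deg X w x * heat_kernel X w x k z) = w z y * heat_kernel X w z k x"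
      unfolding Suc.IH[OF Suc.prems(1) z]
      using deg_nonzeroD[OF pos z] sym[OF z Suc.prems(2)] by simp
  qed
  also have "\<dots> = deg X w y * heat_kernel X w y (Suc k) x"
    unfolding heat_kernel_Suc_source[OF fin Suc.prems]
    using deg_nonzeroD[OF pos Suc.prems(2)] by (simp add: sum_distrib_left mult.commute)
  finally show ?case .
qed

text \<open>By symmetry of \<open>w\<close> the column of \<open>z\<close> sums to
  \<open>deg X w z\<close>, so each step redistributes the mass at \<open>z\<close> without
  loss.\<close>

lemma sum_heat_kernel:
  assumes graph: "weighted_graph X w"
    and pos: "\<And>x. x \<in> X \<Longrightarrow> deg X w x > 0"
    and "x \<in> X"
  shows "(\<Sum>y\<in>X. heat_kernel X w x k y) = real (card X)"
proof (induction k)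
  case 0
  show ?case
    using graph sum_delta_mult[of X x "\<lambda>_. 1"] assms(3) by (simp add: weighted_graph_def)
next
  case (Suc k)
  have "(\<Sum>y\<in>X. heat_kernel X w x (Suc k) y)
      = (\<Sum>z\<in>X. \<Sum>y\<in>X. w y z / deg X w z * heat_kernel X w x k z)"
    unfolding heat_kernel.simps by (rule sum.swap)
  also have "\<dots> = (\<Sum>z\<in>X. heat_kernel X w x k z)"
  proof (rule sum.cong[OF refl])
    fix z assume z: "z \<in> X"
    have "(\<Sum>y\<in>X. w y z) = deg X w z"
      unfolding deg_def using graph z by (intro sum.cong) (auto simp: weighted_graph_def)
    then show "(\<Sum>y\<in>X. w y z / deg X w z * heat_kernel X w x k z) = heat_kernel X w x k z"
      using deg_nonzeroD[OF pos z]
      by (simp flip: sum_distrib_right sum_divide_distrib)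
  qed
  finally show ?case
    using Suc.IH by simp
qed

lemma deg_mean_heat_conv:
  assumes graph: "weighted_graph X w"
    and pos: "\<And>x. x \<in> X \<Longrightarrow> deg X w x > 0"
  shows "deg_mean X w (heat_conv X w k u) = deg_mean X w u"
\<comment> \<open>The main case cancels \<open>real (card X)\<close>; for empty \<open>X\<close>
  both means are quotients of empty sums.\<close>
proof (cases "X = {}")
  case True
  then show ?thesis
    by (simp add: deg_mean_def)
next
  case False
  then have card: "real (card X) \<noteq> 0"
    using graph by (simp add: weighted_graph_def)
  have "real (card X) * (\<Sum>x\<in>X. deg X w x * heat_conv X w k u x)
      = (\<Sum>x\<in>X. \<Sum>y\<in>X. deg X w x * heat_kernel X w x k y * u y)"
    using card by (simp add: heat_conv_def sum_distrib_left mult.assoc mult.left_commute)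
  also have "\<dots> = (\<Sum>y\<in>X. \<Sum>x\<in>X. deg X w x * heat_kernel X w x k y * u y)"
    by (rule sum.swap)
  \<comment> \<open>Now \<open>x\<close> is the evaluation point instead of the source, so
    conservation of mass applies to the inner sum.\<close>
  also have "\<dots> = (\<Sum>y\<in>X. \<Sum>x\<in>X. deg X w y * heat_kernel X w y k x * u y)"
    by (intro sum.cong refl) (simp add: heat_kernel_reversible[OF graph pos])
  also have "\<dots> = (\<Sum>y\<in>X. deg X w y * (\<Sum>x\<in>X. heat_kernel X w y k x) * u y)"
    by (simp add: sum_distrib_left sum_distrib_right)
  also have "\<dots> = (\<Sum>y\<in>X. real (card X) * (deg X w y * u y))"
    by (intro sum.cong refl) (simp add: sum_heat_kernel[OF graph pos])
  also have "\<dots> = real (card X) * (\<Sum>y\<in>X. deg X w y * u y)"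
    by (simp add: sum_distrib_left)
  finally show ?thesis
    using card by (simp add: deg_mean_def)
qed

lemma heat_conv_0:
  assumes "finite X" "x \<in> X"
  shows "heat_conv X w 0 u x = u x"
proof -
  have "card X \<noteq> 0"
    using assms by auto
  then show ?thesis
    using sum_delta_mult[OF assms, of u] by (simp add: heat_conv_def mult.commute)
qed

text \<open>Exchanging the sums moves the last step from the kernel onto \<open>u\<close>, where its
  transpose averages over neighbours; both convolutions then use the kernel at time
  \<open>k\<close>.\<close>

lemma heat_conv_diff_Suc:
  assumes graph: "weighted_graph X w"
    and pos: "\<And>x. x \<in> X \<Longrightarrow> deg X w x > 0"
  shows "heat_conv X w k u x - heat_conv X w (Suc k) u x
    = heat_conv X w k (\<lambda>z. graph_laplacian X w u z / deg X w z) x"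
proof -
  have "(\<Sum>y\<in>X. heat_kernel X w x (Suc k) y * u y)
      = (\<Sum>z\<in>X. \<Sum>y\<in>X. w y z / deg X w z * heat_kernel X w x k z * u y)"
    unfolding heat_kernel.simps sum_distrib_right by (rule sum.swap)
  also have "\<dots> = (\<Sum>z\<in>X. heat_kernel X w x k z * (u z - graph_laplacian X w u z / deg X w z))"
  proof (rule sum.cong[OF refl])
    fix z assume z: "z \<in> X"
    have "graph_laplacian X w u z = deg X w z * u z - (\<Sum>y\<in>X. w z y * u y)"
      by (simp add: graph_laplacian_def deg_def right_diff_distrib sum_subtractf sum_distrib_right)
    moreover have "(\<Sum>y\<in>X. w z y * u y) = (\<Sum>y\<in>X. w y z * u y)"
      using graph z by (intro sum.cong) (auto simp: weighted_graph_def)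
    ultimately have "u z - graph_laplacian X w u z / deg X w z
        = (\<Sum>y\<in>X. w y z * u y) / deg X w z"
      using deg_nonzeroD[OF pos z] by (simp add: diff_divide_distrib)
    then show "(\<Sum>y\<in>X. w y z / deg X w z * heat_kernel X w x k z * u y)
        = heat_kernel X w x k z * (u z - graph_laplacian X w u z / deg X w z)"
      by (simp add: sum_distrib_left sum_divide_distrib mult_ac)
  qed
  finally show ?thesis
    by (simp add: heat_conv_def right_diff_distrib sum_subtractf diff_divide_distrib)
qed

text \<open>The mass at \<open>y\<close> picks out the kernel from \<open>x\<close> at
  \<open>y\<close> divided by \<open>deg X w y\<close>. Reversibility trades this for the kernel
  from \<open>y\<close> at \<open>x\<close> divided by \<open>deg X w x\<close>, a factor common to
  all \<open>y\<close>.\<close>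

lemma heat_conv_sum_delta:
  assumes graph: "weighted_graph X w"
    and pos: "\<And>x. x \<in> X \<Longrightarrow> deg X w x > 0"
    and "\<Gamma> \<subseteq> X" "x \<in> X"
  shows "heat_conv X w k (\<lambda>z. (\<Sum>y\<in>\<Gamma>. a y * delta X y z) / deg X w z) x
    = inverse (deg X w x) * (\<Sum>y\<in>\<Gamma>. a y * heat_kernel X w y k x)"
proof -
  have fin: "finite X"
    using graph by (simp add: weighted_graph_def)
  then have card: "real (card X) \<noteq> 0"
    using assms(4) by auto
  have "(\<Sum>z\<in>X. heat_kernel X w x k z * ((\<Sum>y\<in>\<Gamma>. a y * delta X y z) / deg X w z))
      = (\<Sum>z\<in>X. \<Sum>y\<in>\<Gamma>. (a y * heat_kernel X w x k z / deg X w z) * delta X y z)"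
    by (simp add: sum_distrib_left sum_divide_distrib mult_ac)
  also have "\<dots> = (\<Sum>y\<in>\<Gamma>. \<Sum>z\<in>X. (a y * heat_kernel X w x k z / deg X w z) * delta X y z)"
    by (rule sum.swap)
  also have "\<dots> = (\<Sum>y\<in>\<Gamma>. real (card X) * (a y * heat_kernel X w y k x / deg X w x))"
  proof (rule sum.cong[OF refl])
    fix y assume "y \<in> \<Gamma>"
    then have y: "y \<in> X"
      using assms(3) by blast
    have "heat_kernel X w x k y / deg X w y = heat_kernel X w y k x / deg X w x"
      using heat_kernel_reversible[OF graph pos assms(4) y, of k]
        deg_nonzeroD[OF pos y] deg_nonzeroD[OF pos assms(4)]
      by (simp add: field_simps)
    then show "(\<Sum>z\<in>X. (a y * heat_kernel X w x k z / deg X w z) * delta X y z)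
        = real (card X) * (a y * heat_kernel X w y k x / deg X w x)"
      unfolding sum_delta_mult[OF fin y] times_divide_eq_right[symmetric] by simp
  qed
  also have "\<dots> = real (card X) *
      (inverse (deg X w x) * (\<Sum>y\<in>\<Gamma>. a y * heat_kernel X w y k x))"
    by (simp add: sum_distrib_left divide_inverse mult_ac)
  finally show ?thesis
    using card by (simp add: heat_conv_def)
qed

theorem theorem4p10:
  fixes X \<Gamma> :: "'a set" and w :: "'a \<Rightarrow> 'a \<Rightarrow> real"
    and u a :: "'a \<Rightarrow> real" and k :: nat
  assumes "weighted_graph X w"
    and "\<And>x. x \<in> X \<Longrightarrow> deg X w x > 0"
    and "\<Gamma> \<subseteq> X"
    and "\<And>x. x \<in> X \<Longrightarrow> graph_laplacian X w u x = (\<Sum>y\<in>\<Gamma>. a y * delta X y x)"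
    and "(\<Sum>y\<in>\<Gamma>. a y) = 0"
    and "k \<ge> 1"
  shows "deg_mean X w (heat_conv X w k u) = deg_mean X w u \<and>
    (\<forall>x\<in>X. u x - heat_conv X w k u x
       = inverse (deg X w x) * (\<Sum>y\<in>\<Gamma>. a y * (\<Sum>j = 0..k - 1. heat_kernel X w y j x)))"
proof (intro conjI ballI)
  show "deg_mean X w (heat_conv X w k u) = deg_mean X w u"
    by (rule deg_mean_heat_conv[OF assms(1,2)])
next
  fix x assume x: "x \<in> X"
  have fin: "finite X"
    using assms(1) by (simp add: weighted_graph_def)
  \<comment> \<open>Subtraction on \<open>nat\<close> truncates: at \<open>k = 0\<close> the left
    side would be \<open>{0}\<close>, hence the appeal to \<open>k \<ge> 1\<close>.\<close>
  have range: "{0..k - 1} = {..<k}"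
    using assms(6) by auto
  have step: "heat_conv X w j u x - heat_conv X w (Suc j) u x
      = inverse (deg X w x) * (\<Sum>y\<in>\<Gamma>. a y * heat_kernel X w y j x)" for j
  proof -
    \<comment> \<open>Convolution evaluates its argument only on \<open>X\<close>, where the Poisson
      equation is available.\<close>
    have "heat_conv X w j (\<lambda>z. graph_laplacian X w u z / deg X w z) x
        = heat_conv X w j (\<lambda>z. (\<Sum>y\<in>\<Gamma>. a y * delta X y z) / deg X w z) x"
      by (simp add: heat_conv_def assms(4))
    then show ?thesis
      using heat_conv_diff_Suc[OF assms(1,2)] heat_conv_sum_delta[OF assms(1,2,3) x] by simp
  qed
  \<comment> \<open>The telescoping sum leaves the terms at \<open>0\<close> and \<open>k\<close>;
    the former is \<open>u x\<close> by \<open>heat_conv_0\<close>.\<close>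
  have "u x - heat_conv X w k u x = (\<Sum>j<k. heat_conv X w j u x - heat_conv X w (Suc j) u x)"
    using sum_lessThan_telescope'[of "\<lambda>j. heat_conv X w j u x" k] heat_conv_0[OF fin x]
    by simp
  also have "\<dots> = inverse (deg X w x) * (\<Sum>j<k. \<Sum>y\<in>\<Gamma>. a y * heat_kernel X w y j x)"
    by (simp only: step sum_distrib_left)
  also have "(\<Sum>j<k. \<Sum>y\<in>\<Gamma>. a y * heat_kernel X w y j x)
      = (\<Sum>y\<in>\<Gamma>. a y * (\<Sum>j = 0..k - 1. heat_kernel X w y j x))"
    unfolding range sum_distrib_left by (rule sum.swap)
  finally show "u x - heat_conv X w k u x
      = inverse (deg X w x) * (\<Sum>y\<in>\<Gamma>. a y * (\<Sum>j = 0..k - 1. heat_kernel X w y j x))" .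
qed

end
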